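(* Let $(\mathfrak h,\langle\cdot,\cdot\rangle_{\mathfrak h},J_{\mathfrak h})$ be an SKT nilpotent Lie algebra and let $(\mathfrak a,\langle\cdot,\cdot\rangle_{\mathfrak a},J_{\mathfrak a})$ be an abelian Hermitian Lie algebra of dimension $2k$. Let $\theta:\mathfrak a\to\mathrm{Der}(\mathfrak h)$ be a Lie algebra homomorphism such that $\theta(\mathfrak a)\subset\mathfrak{sp}(\mathfrak h)\cap\mathfrak{so}(\mathfrak h)$, namely $$\theta(U)^t=-\theta(U)\quad\text{and}\quad J_{\mathfrak h}\theta(U)+\theta(U)^tJ_{\mathfrak h}=0\qquad\text{for all }U\in\mathfrak a.$$ Then $(\mathfrak g=\mathfrak h\rtimes_\theta\mathfrak a,\langle\cdot,\cdot\rangle,J)$, with $$\langle\cdot,\cdot\rangle=\langle\cdot,\cdot\rangle_{\mathfrak h}+\langle\cdot,\cdot\rangle_{\mathfrak a},\qquad J=\begin{pmatrix}J_{\mathfrak h}&0\\0&J_{\mathfrak a}\end{pmatrix},$$ is SKT.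
   Context: All Lie algebras are real and finite-dimensional. A Hermitian structure on a Lie algebra is a pair $(J,\langle\cdot,\cdot\rangle)$ with $J^2=-\mathrm{Id}$, $J$ integrable ($[X,Y]+J([JX,Y]+[X,JY])-[JX,JY]=0$ for all $X,Y$), and $\langle\cdot,\cdot\rangle$ an inner product with $\langle JX,JY\rangle=\langle X,Y\rangle$. Fundamental form $\omega=\langle J\cdot,\cdot\rangle$; $d$ is the Chevalley–Eilenberg differential; Bismut torsion $c(X,Y,Z)=d\omega(JX,JY,JZ)$. A Hermitian structure (or the Lie algebra endowed with it) is SKT if $dc=0$. $\mathrm{Der}(\mathfrak h)$ is the Lie algebra of derivations of $\mathfrak h$, and ${}^t$ denotes the transpose (adjoint) with respect to $\langle\cdot,\cdot\rangle_{\mathfrak h}$. The semidirect product $\mathfrak h\rtimes_\theta\mathfrak a$ is $\mathfrak h\oplus\mathfrak a$ with $[U,Y]=\theta(U)Y$ for $U\in\mathfrak a$, $Y\in\mathfrak h$, extending the brackets of $\mathfrak h$ and $\mathfrak a$; $J$ and $\langle\cdot,\cdot\rangle$ are written with respect to the splitting $\mathfrak h\oplus\mathfrak a$. *)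

theory Defs
  imports "HOL-Analysis.Analysis"
begin

text \<open>
  A Lie algebra is carried by a whole type and given by its bracket \<open>br\<close>.  The inner product is
  the one of the class \<^class>\<open>real_inner\<close>, and finite dimension is an explicit condition; the
  class \<^class>\<open>euclidean_space\<close> would exclude the zero Lie algebra.
\<close>

definition fin_dim :: "'v::real_vector itself \<Rightarrow> bool" where
  "fin_dim _ \<longleftrightarrow> (\<exists>B::'v set. finite B \<and> span B = UNIV)"

definition lie_algebra :: "('v::real_vector \<Rightarrow> 'v \<Rightarrow> 'v) \<Rightarrow> bool" where
  "lie_algebra br \<longleftrightarrow>
     fin_dim TYPE('v) \<and> bilinear br \<and> (\<forall>X. br X X = 0) \<and>
     (\<forall>X Y Z. br X (br Y Z) + br Y (br Z X) + br Z (br X Y) = 0)"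

definition abelian_bracket :: "('v::real_vector \<Rightarrow> 'v \<Rightarrow> 'v) \<Rightarrow> bool" where
  "abelian_bracket br \<longleftrightarrow> (\<forall>X Y. br X Y = 0)"

primrec lower_central :: "('v::real_vector \<Rightarrow> 'v \<Rightarrow> 'v) \<Rightarrow> nat \<Rightarrow> 'v set" where
  "lower_central br 0 = UNIV"
| "lower_central br (Suc n) = span {br X Y | X Y. Y \<in> lower_central br n}"

definition nilpotent_bracket :: "('v::real_vector \<Rightarrow> 'v \<Rightarrow> 'v) \<Rightarrow> bool" where
  "nilpotent_bracket br \<longleftrightarrow> (\<exists>n. lower_central br n = {0})"

definition integrable_structure :: "('v::real_vector \<Rightarrow> 'v \<Rightarrow> 'v) \<Rightarrow> ('v \<Rightarrow> 'v) \<Rightarrow> bool" where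
  "integrable_structure br J \<longleftrightarrow>
     (\<forall>X Y. br X Y + J (br (J X) Y + br X (J Y)) - br (J X) (J Y) = 0)"

definition hermitian :: "('v::real_inner \<Rightarrow> 'v \<Rightarrow> 'v) \<Rightarrow> ('v \<Rightarrow> 'v) \<Rightarrow> bool" where
  "hermitian br J \<longleftrightarrow>
     lie_algebra br \<and> linear J \<and> (\<forall>X. J (J X) = - X) \<and> integrable_structure br J \<and>
     (\<forall>X Y. inner (J X) (J Y) = inner X Y)"

text \<open>
  A \<open>p\<close>-form is a function on argument lists, only its values on lists of length \<open>p\<close> being
  relevant.  The Chevalley-Eilenberg differential (trivial coefficients) is
  \<open>d\<alpha>(X\<^sub>0,...,X\<^sub>p) = \<Sum>i<j. (-1)\<^sup>i\<^sup>+\<^sup>j \<alpha>([X\<^sub>i,X\<^sub>j], X\<^sub>0, ..., X\<^sub>p)\<close> with \<open>X\<^sub>i\<close> and \<open>X\<^sub>j\<close> omitted on the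
  right; \<open>nths Xs (- {i, j})\<close> deletes these two entries.
\<close>

definition ce_diff :: "('v::real_vector \<Rightarrow> 'v \<Rightarrow> 'v) \<Rightarrow> ('v list \<Rightarrow> real) \<Rightarrow> 'v list \<Rightarrow> real" where
  "ce_diff br \<alpha> Xs =
     (\<Sum>j<length Xs. \<Sum>i<j. (-1) ^ (i + j) * \<alpha> (br (Xs ! i) (Xs ! j) # nths Xs (- {i, j})))"

lemma ce_diff_2form:
  "ce_diff br \<alpha> [X, Y, Z] = - \<alpha> [br X Y, Z] + \<alpha> [br X Z, Y] - \<alpha> [br Y Z, X]"
  by (simp add: ce_diff_def nths_Cons numeral_2_eq_2)

lemma ce_diff_3form:
  "ce_diff br \<alpha> [X, Y, Z, W] =
     - \<alpha> [br X Y, Z, W] + \<alpha> [br X Z, Y, W] - \<alpha> [br X W, Y, Z]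
     - \<alpha> [br Y Z, X, W] + \<alpha> [br Y W, X, Z] - \<alpha> [br Z W, X, Y]"
  by (simp add: ce_diff_def nths_Cons eval_nat_numeral)

definition fundamental_form :: "('v::real_inner \<Rightarrow> 'v) \<Rightarrow> 'v list \<Rightarrow> real" where
  "fundamental_form J Xs = inner (J (Xs ! 0)) (Xs ! 1)"

definition bismut_torsion ::
    "('v::real_inner \<Rightarrow> 'v \<Rightarrow> 'v) \<Rightarrow> ('v \<Rightarrow> 'v) \<Rightarrow> 'v list \<Rightarrow> real" where
  "bismut_torsion br J Xs = ce_diff br (fundamental_form J) (map J Xs)"

definition skt :: "('v::real_inner \<Rightarrow> 'v \<Rightarrow> 'v) \<Rightarrow> ('v \<Rightarrow> 'v) \<Rightarrow> bool" where
  "skt br J \<longleftrightarrow>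
     hermitian br J \<and> (\<forall>X Y Z W. ce_diff br (bismut_torsion br J) [X, Y, Z, W] = 0)"

definition Der :: "('v::real_vector \<Rightarrow> 'v \<Rightarrow> 'v) \<Rightarrow> ('v \<Rightarrow> 'v) set" where
  "Der br = {D. linear D \<and> (\<forall>X Y. D (br X Y) = br (D X) Y + br X (D Y))}"

text \<open>
  Linearity of \<open>\<theta>\<close> is stated pointwise, as \<open>'h \<Rightarrow> 'h\<close> is not an instance of
  \<^class>\<open>real_vector\<close>; the bracket on \<open>Der\<close> is the commutator.
\<close>

definition lie_hom_Der ::
    "('a::real_vector \<Rightarrow> 'a \<Rightarrow> 'a) \<Rightarrow> ('h::real_vector \<Rightarrow> 'h \<Rightarrow> 'h) \<Rightarrow> ('a \<Rightarrow> 'h \<Rightarrow> 'h) \<Rightarrow> bool" where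
  "lie_hom_Der brA brH \<theta> \<longleftrightarrow>
     (\<forall>U. \<theta> U \<in> Der brH) \<and> (\<forall>Y. linear (\<lambda>U. \<theta> U Y)) \<and>
     (\<forall>U V Y. \<theta> (brA U V) Y = \<theta> U (\<theta> V Y) - \<theta> V (\<theta> U Y))"

definition semidirect_bracket ::
    "('h::real_vector \<Rightarrow> 'h \<Rightarrow> 'h) \<Rightarrow> ('a::real_vector \<Rightarrow> 'a \<Rightarrow> 'a) \<Rightarrow> ('a \<Rightarrow> 'h \<Rightarrow> 'h)
      \<Rightarrow> 'h \<times> 'a \<Rightarrow> 'h \<times> 'a \<Rightarrow> 'h \<times> 'a" where
  "semidirect_bracket brH brA \<theta> =
     (\<lambda>(Y, U) (Z, V). (brH Y Z + \<theta> U Z - \<theta> V Y, brA U V))"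

text \<open>
  The inner product of \<open>h \<oplus> a\<close> needs no definition: the library instance on \<open>'h \<times> 'a\<close> is the sum
  of the two inner products (\<open>inner_Pair\<close>).
\<close>

end

theory Submission
  imports Defs
begin

text \<open>
  Every operator \<open>\<theta> U\<close> is a skew-symmetric derivation of \<open>h\<close> commuting with \<open>J\<close>, so its
  flow consists of automorphisms of the whole Hermitian structure of \<open>h\<close>.  Hence any form built
  naturally from that structure, in particular the fundamental form and the torsion of \<open>h\<close>, has
  vanishing Lie derivative along \<open>\<theta> U\<close>.

  On the other hand, evaluating the Chevalley-Eilenberg differential of the semidirect product on
  the pullback of a form from \<open>h\<close> produces the pullback of the differential on \<open>h\<close>, plus terms
  containing \<open>\<theta>\<close>; those in which a fixed argument contributes its \<open>a\<close>-component \<open>U\<close> add up to a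
  Lie derivative along \<open>\<theta> U\<close>.  Applied to the fundamental form this shows that the torsion of
  the semidirect product is the sum of the pullbacks of the torsions of \<open>h\<close> and \<open>a\<close>
  (\<open>bismut_torsion_semidirect\<close>).  Applied once more, to the torsion of \<open>h\<close>, which is invariant by
  \<open>bismut_torsion_invariant\<close>, it shows that the differential of this sum is the sum of the two
  pulled back differentials.  The semidirect product is therefore SKT as soon as both factors
  are, and an abelian Hermitian Lie algebra is SKT because its torsion is zero.

  The remaining conditions on the semidirect product are direct: the Jacobi identity expresses
  that \<open>\<theta>\<close> is a homomorphism into derivations, and the Nijenhuis tensor receives no contribution
  from \<open>\<theta>\<close> because \<open>\<theta> U\<close> commutes with \<open>J\<close>.
\<close>

section \<open>Adjoints in finite dimension\<close>

text \<open>
  The constant \<^const>\<open>adjoint\<close> is a choice, meaningful only once some adjoint is known to exist.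
  An orthogonal spanning set gives one explicitly, by expanding the image in coordinates.
\<close>

lemma adjoint_works_fin_dim:
  fixes f :: "'v::real_inner \<Rightarrow> 'v"
  assumes "fin_dim TYPE('v)" and f: "linear f"
  shows "inner (f x) y = inner x (adjoint f y)"
proof -
  obtain B :: "'v set" where "finite B" "span B = UNIV"
    using assms(1) by (auto simp: fin_dim_def)
  then obtain C :: "'v set" where C: "finite C" "span C = UNIV" "pairwise orthogonal C"
    using basis_orthogonal[of B] by auto
  define g where "g y = (\<Sum>c\<in>C. (inner (f c) y / inner c c) *\<^sub>R c)" for y
  have "inner (f x) y = inner x (g y)" for x y
  proof -
    have "x \<in> span C" using C by simp
    then show ?thesis
    proof (induction rule: span_induct_alt)
      case base
      show ?case using linear_0[OF f] by simp
    next
      case (step a c z)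
      have "inner c (g y) = (\<Sum>b\<in>C. if b = c then inner (f c) y else 0)"
        unfolding g_def inner_sum_right
      proof (rule sum.cong[OF refl])
        fix b assume "b \<in> C"
        (* an orthogonal set may contain 0, where the quotient is 0 and so is f 0 *)
        then show "inner c ((inner (f b) y / inner b b) *\<^sub>R b) =
            (if b = c then inner (f c) y else 0)"
          using C(3) step(1) linear_0[OF f] by (auto simp: pairwise_def orthogonal_def)
      qed
      then have "inner c (g y) = inner (f c) y"
        using C(1) step(1) by simp
      then show ?case
        using step.IH by (simp add: linear_add[OF f] linear_cmul[OF f] inner_add_left)
    qed
  qed
  then have "\<forall>x y. inner (f x) y = inner x (g y)" by blast
  then have "\<forall>x y. inner (f x) y = inner x (adjoint f y)"
    unfolding adjoint_def by (rule someI[of _ g])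
  then show ?thesis by blast
qed

section \<open>The torsion of a Hermitian Lie algebra\<close>

lemma hermitianD:
  assumes "hermitian br J"
  shows "lie_algebra br" "linear J" "J (J X) = - X" "integrable_structure br J"
    "inner (J X) (J Y) = inner X Y"
  using assms by (auto simp: hermitian_def)

lemma lie_algebraD:
  assumes "lie_algebra (br :: 'v::real_vector \<Rightarrow> 'v \<Rightarrow> 'v)"
  shows "fin_dim TYPE('v)" "bilinear br" "br X X = 0"
    "br X (br Y Z) + br Y (br Z X) + br Z (br X Y) = 0"
  using assms by (auto simp: lie_algebra_def)

lemma lie_bracket_antisym:
  assumes "lie_algebra br"
  shows "br Y X = - br X Y"
proof -
  have "br (X + Y) (X + Y) = br X X + br X Y + (br Y X + br Y Y)"
    by (simp only: bilinear_ladd[OF lie_algebraD(2)[OF assms]]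
        bilinear_radd[OF lie_algebraD(2)[OF assms]] ac_simps)
  then have "br X Y + br Y X = 0"
    by (simp only: lie_algebraD(3)[OF assms]) simp
  then show ?thesis by (simp add: eq_neg_iff_add_eq_0 add.commute)
qed

lemma bismut_torsion_eq:
  assumes "hermitian br J"
  shows "bismut_torsion br J [X, Y, Z] =
    - inner (br (J X) (J Y)) Z + inner (br (J X) (J Z)) Y - inner (br (J Y) (J Z)) X"
  by (simp add: bismut_torsion_def ce_diff_2form fundamental_form_def hermitianD(5)[OF assms])

lemma bismut_torsion_swap:
  assumes "hermitian br J"
  shows "bismut_torsion br J [Y, X, Z] = - bismut_torsion br J [X, Y, Z]"
    and "bismut_torsion br J [X, Z, Y] = - bismut_torsion br J [X, Y, Z]"
  using lie_bracket_antisym[OF hermitianD(1)[OF assms], of "J Y" "J X"]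
    lie_bracket_antisym[OF hermitianD(1)[OF assms], of "J Z" "J Y"]
  by (simp_all add: bismut_torsion_eq[OF assms])

lemma bismut_torsion_add:
  assumes "hermitian br J"
  shows "bismut_torsion br J [X + X', Y, Z] =
    bismut_torsion br J [X, Y, Z] + bismut_torsion br J [X', Y, Z]"
  using lie_algebraD(2)[OF hermitianD(1)[OF assms]] hermitianD(2)[OF assms]
  by (simp add: bismut_torsion_eq[OF assms] linear_add bilinear_ladd inner_add_left
      inner_add_right)

lemma bismut_torsion_diff:
  assumes "hermitian br J"
  shows "bismut_torsion br J [X - X', Y, Z] =
    bismut_torsion br J [X, Y, Z] - bismut_torsion br J [X', Y, Z]"
  using bismut_torsion_add[OF assms, of "X - X'" X' Y Z] by simp

text \<open>
  Differentiating, at the identity, the invariance of the torsion under automorphisms of the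
  Hermitian structure.  Each of the three summands of the torsion is separately invariant.
\<close>

lemma bismut_torsion_invariant:
  assumes herm: "hermitian br J" and D: "D \<in> Der br"
    and skew: "\<And>X Y. inner (D X) Y = - inner X (D Y)"
    and comm: "\<And>X. D (J X) = J (D X)"
  shows "bismut_torsion br J [D X, Y, Z] + bismut_torsion br J [X, D Y, Z] +
    bismut_torsion br J [X, Y, D Z] = 0"
proof -
  have summand: "inner (br (J (D X)) (J Y)) Z + inner (br (J X) (J (D Y))) Z +
      inner (br (J X) (J Y)) (D Z) = 0" for X Y Z
  proof -
    have "br (J (D X)) (J Y) + br (J X) (J (D Y)) = D (br (J X) (J Y))"
      using D by (simp add: Der_def comm)
    then show ?thesis
      using skew[of "br (J X) (J Y)" Z] by (simp flip: inner_add_left)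
  qed
  show ?thesis
    using summand[of X Y Z] summand[of X Z Y] summand[of Y Z X]
    by (simp add: bismut_torsion_eq[OF herm])
qed

lemma skt_abelian:
  assumes "hermitian br J" and "abelian_bracket br"
  shows "skt br J"
  using assms
  by (simp add: skt_def abelian_bracket_def ce_diff_3form bismut_torsion_eq[OF assms(1)])

section \<open>Semidirect products\<close>

lemma semidirect_bracket_Pair [simp]:
  "semidirect_bracket brH brA \<theta> (Y, U) (Z, V) = (brH Y Z + \<theta> U Z - \<theta> V Y, brA U V)"
  by (simp add: semidirect_bracket_def)

lemma lie_hom_DerD:
  assumes "lie_hom_Der brA brH \<theta>"
  shows "\<theta> U \<in> Der brH" "linear (\<theta> U)" "linear (\<lambda>U. \<theta> U Y)"
    "\<theta> U (brH Y Z) = brH (\<theta> U Y) Z + brH Y (\<theta> U Z)"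
    "\<theta> (brA U V) Y = \<theta> U (\<theta> V Y) - \<theta> V (\<theta> U Y)"
  using assms unfolding lie_hom_Der_def Der_def by blast+

lemma fin_dim_prod:
  assumes "fin_dim TYPE('h::real_vector)" and "fin_dim TYPE('a::real_vector)"
  shows "fin_dim TYPE('h \<times> 'a)"
proof -
  obtain B :: "'h set" and C :: "'a set"
    where "finite B" "span B = UNIV" "finite C" "span C = UNIV"
    using assms by (auto simp: fin_dim_def)
  then have "finite (B \<times> {0} \<union> {0} \<times> C)" "span (B \<times> {0} \<union> {0} \<times> C) = (UNIV :: ('h \<times> 'a) set)"
    by (auto simp: span_Times_sing1 span_Times_sing2 span_Un)
  then show ?thesis unfolding fin_dim_def by blast
qed

lemma lie_algebra_semidirect:
  assumes H: "lie_algebra brH" and A: "lie_algebra brA" and hom: "lie_hom_Der brA brH \<theta>"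
  shows "lie_algebra (semidirect_bracket brH brA \<theta>)"
proof -
  note bH = lie_algebraD(2)[OF H] and bA = lie_algebraD(2)[OF A]
  note lin = lie_hom_DerD(2,3)[OF hom]
  have "bilinear (semidirect_bracket brH brA \<theta>)"
    unfolding bilinear_def
  proof (intro conjI allI; rule linearI)
    note [simp] = bilinear_ladd[OF bH] bilinear_radd[OF bH] bilinear_ladd[OF bA] 
      bilinear_radd[OF bA] bilinear_lmul[OF bH] bilinear_rmul[OF bH] bilinear_lmul[OF bA]
      bilinear_rmul[OF bA] linear_add[OF lin(1)] linear_add[OF lin(2)]
      linear_cmul[OF lin(1)] linear_cmul[OF lin(2)]
    let ?b = "semidirect_bracket brH brA \<theta>"
    fix X Y Z :: "'a \<times> 'b" and r :: real
    show "?b X (Y + Z) = ?b X Y + ?b X Z" "?b (Y + Z) X = ?b Y X + ?b Z X"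
      by (cases X; cases Y; cases Z; simp add: algebra_simps)+
    show "?b X (r *\<^sub>R Y) = r *\<^sub>R ?b X Y" "?b (r *\<^sub>R Y) X = r *\<^sub>R ?b Y X"
      by (cases X; cases Y; simp add: algebra_simps)+
  qed
  moreover have "semidirect_bracket brH brA \<theta> X X = 0" for X
    by (cases X) (simp add: lie_algebraD(3)[OF H] lie_algebraD(3)[OF A] zero_prod_def)
  moreover have "semidirect_bracket brH brA \<theta> X (semidirect_bracket brH brA \<theta> Y Z) +
      semidirect_bracket brH brA \<theta> Y (semidirect_bracket brH brA \<theta> Z X) +
      semidirect_bracket brH brA \<theta> Z (semidirect_bracket brH brA \<theta> X Y) = 0" for X Y Z
  proof -
    obtain x u y v z w where XYZ: "X = (x, u)" "Y = (y, v)" "Z = (z, w)"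
      by (cases X, cases Y, cases Z) auto
    (* the derivation terms leave brackets in both orders; this fixes one order for each *)
    note anti = lie_bracket_antisym[OF H, of "\<theta> u y" z] lie_bracket_antisym[OF H, of "\<theta> u z" y]
      lie_bracket_antisym[OF H, of "\<theta> v x" z] lie_bracket_antisym[OF H, of "\<theta> v z" x]
      lie_bracket_antisym[OF H, of "\<theta> w x" y] lie_bracket_antisym[OF H, of "\<theta> w y" x]
    have "brH x (brH y z) = - brH y (brH z x) - brH z (brH x y)"
      using lie_algebraD(4)[OF H, of x y z] by (simp add: algebra_simps eq_neg_iff_add_eq_0)
    then show ?thesis
      by (simp add: XYZ zero_prod_def lie_algebraD(4)[OF A] lie_hom_DerD(4,5)[OF hom] anti
          bilinear_radd[OF bH] bilinear_rsub[OF bH] linear_add[OF lin(1)] linear_diff[OF lin(1)])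
  qed
  ultimately show ?thesis
    using fin_dim_prod lie_algebraD(1)[OF H] lie_algebraD(1)[OF A]
    by (simp add: lie_algebra_def)
qed

lemma hermitian_semidirect:
  assumes H: "hermitian brH JH" and A: "hermitian brA JA" and hom: "lie_hom_Der brA brH \<theta>"
    and comm: "\<And>U Y. \<theta> U (JH Y) = JH (\<theta> U Y)"
  shows "hermitian (semidirect_bracket brH brA \<theta>) (map_prod JH JA)"
proof -
  note linH = hermitianD(2)[OF H] and linA = hermitianD(2)[OF A]
  have "linear (map_prod JH JA)"
    by (rule linearI)
      (auto simp: linear_add[OF linH] linear_add[OF linA] linear_cmul[OF linH] linear_cmul[OF linA])
  moreover have "integrable_structure (semidirect_bracket brH brA \<theta>) (map_prod JH JA)"
  proof -
    have nijH: "brH y z + JH (brH (JH y) z + brH y (JH z)) - brH (JH y) (JH z) = 0" for y z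
      using hermitianD(4)[OF H] by (simp add: integrable_structure_def)
    have nijA: "brA u v + JA (brA (JA u) v + brA u (JA v)) - brA (JA u) (JA v) = 0" for u v
      using hermitianD(4)[OF A] by (simp add: integrable_structure_def)
    have "brH y z = brH (JH y) (JH z) - JH (brH (JH y) z) - JH (brH y (JH z))" for y z
      using nijH[of y z] by (simp add: linear_add[OF linH] algebra_simps)
    then show ?thesis
      using nijA
      by (auto simp: integrable_structure_def zero_prod_def comm linear_add[OF linH]
          linear_diff[OF linH] hermitianD(3)[OF H] algebra_simps)
  qed
  ultimately show ?thesis
    using lie_algebra_semidirect[OF hermitianD(1)[OF H] hermitianD(1)[OF A] hom]
    by (auto simp: hermitian_def hermitianD(3,5)[OF H] hermitianD(3,5)[OF A])
qed

text \<open>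
  The terms in which \<open>\<theta>\<close> is taken at the \<open>a\<close>-component of one argument come in pairs, with \<open>\<theta>\<close>
  acting on either of the two other arguments.  The two cancel because \<open>J\<close> composed with \<open>\<theta> U\<close>, as
  a product of commuting skew-symmetric operators, is symmetric.
\<close>

lemma bismut_torsion_semidirect:
  assumes H: "hermitian brH JH" and A: "hermitian brA JA" and hom: "lie_hom_Der brA brH \<theta>"
    and skew: "\<And>U X Y. inner (\<theta> U X) Y = - inner X (\<theta> U Y)"
    and comm: "\<And>U Y. \<theta> U (JH Y) = JH (\<theta> U Y)"
  shows "bismut_torsion (semidirect_bracket brH brA \<theta>) (map_prod JH JA) [(x, u), (y, v), (z, w)] =
    bismut_torsion brH JH [x, y, z] + bismut_torsion brA JA [u, v, w]"
proof -
  have move: "inner (JH (\<theta> U X)) Y = inner (JH (\<theta> U Y)) X" for U X Y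
  proof -
    have "inner (JH (\<theta> U X)) Y = - inner (JH X) (\<theta> U Y)"
      using skew[of U "JH X" Y] by (simp add: comm)
    also have "\<dots> = - inner (JH (JH X)) (JH (\<theta> U Y))"
      by (simp only: hermitianD(5)[OF H])
    finally show ?thesis by (simp add: hermitianD(3)[OF H] inner_commute)
  qed
  show ?thesis
    by (simp add: bismut_torsion_eq[OF hermitian_semidirect[OF H A hom, OF comm]]
        bismut_torsion_eq[OF H] bismut_torsion_eq[OF A] inner_add_left inner_diff_left comm
        move[of _ x y] move[of _ x z] move[of _ y z])
qed

text \<open>
  In the differential of the torsion, the terms in which \<open>\<theta>\<close> is taken at the \<open>a\<close>-component of one
  argument form the Lie derivative of the torsion of \<open>h\<close>, evaluated on the other three arguments.
\<close>

theorem skt_semidirect: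
  assumes H: "skt brH JH" and A: "skt brA JA" and hom: "lie_hom_Der brA brH \<theta>"
    and skew: "\<And>U X Y. inner (\<theta> U X) Y = - inner X (\<theta> U Y)"
    and comm: "\<And>U Y. \<theta> U (JH Y) = JH (\<theta> U Y)"
  shows "skt (semidirect_bracket brH brA \<theta>) (map_prod JH JA)"
proof -
  have hH: "hermitian brH JH" and hA: "hermitian brA JA"
    using H A by (auto simp: skt_def)
  let ?b = "semidirect_bracket brH brA \<theta>" and ?J = "map_prod JH JA"
  let ?c = "bismut_torsion brH JH"
  have "ce_diff ?b (bismut_torsion ?b ?J) [X, Y, Z, W] = 0" for X Y Z W
  proof -
    obtain x u y v z w t s where XYZW: "X = (x, u)" "Y = (y, v)" "Z = (z, w)" "W = (t, s)"
      by (cases X, cases Y, cases Z, cases W) auto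
    have dH: "ce_diff brH ?c [x, y, z, t] = 0"
      using H by (simp add: skt_def)
    have dA: "ce_diff brA (bismut_torsion brA JA) [u, v, w, s] = 0"
      using A by (simp add: skt_def)
    (* the differential has the bracket in the first slot, so the Lie derivative is rewritten
       with the operator there *)
    have inv: "?c [\<theta> U X, Y, Z] - ?c [\<theta> U Y, X, Z] + ?c [\<theta> U Z, X, Y] = 0" for U X Y Z
      using bismut_torsion_invariant[OF hH lie_hom_DerD(1)[OF hom], OF skew comm, of U X Y Z]
        bismut_torsion_swap[OF hH, of "\<theta> U Y" X Z] bismut_torsion_swap(2)[OF hH, of X Y "\<theta> U Z"]
        bismut_torsion_swap(1)[OF hH, of X "\<theta> U Z" Y]
      by simp
    show ?thesis
      using dH dA inv[of u y z t] inv[of v x z t] inv[of w x y t] inv[of s x y z]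
      by (simp add: XYZW ce_diff_3form bismut_torsion_semidirect[OF hH hA hom, OF skew comm]
          bismut_torsion_add[OF hH] bismut_torsion_diff[OF hH])
  qed
  then show ?thesis
    using hermitian_semidirect[OF hH hA hom, OF comm] by (simp add: skt_def)
qed

theorem theorem5p2:
  fixes brH :: "'h::real_inner \<Rightarrow> 'h \<Rightarrow> 'h" and JH :: "'h \<Rightarrow> 'h"
    and brA :: "'a::real_inner \<Rightarrow> 'a \<Rightarrow> 'a" and JA :: "'a \<Rightarrow> 'a"
    and \<theta> :: "'a \<Rightarrow> 'h \<Rightarrow> 'h" and k :: nat
  assumes "skt brH JH" and "nilpotent_bracket brH"
    and "hermitian brA JA" and "abelian_bracket brA" and "dim (UNIV :: 'a set) = 2 * k"
    and "lie_hom_Der brA brH \<theta>"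
    and "\<And>U. adjoint (\<theta> U) = (\<lambda>Y. - \<theta> U Y)"
    and "\<And>U Y. JH (\<theta> U Y) + adjoint (\<theta> U) (JH Y) = 0"
  shows "skt (semidirect_bracket brH brA \<theta>) (map_prod JH JA)"
proof (rule skt_semidirect[OF assms(1) skt_abelian[OF assms(3,4)] assms(6)])
  fix U X Y
  have "fin_dim TYPE('h)"
    using assms(1) by (simp add: skt_def hermitian_def lie_algebra_def)
  then show "inner (\<theta> U X) Y = - inner X (\<theta> U Y)"
    using adjoint_works_fin_dim[of "\<theta> U" X Y] lie_hom_DerD(2)[OF assms(6)] assms(7)
    by simp
next
  fix U Y
  show "\<theta> U (JH Y) = JH (\<theta> U Y)"
    using assms(7)[of U] assms(8)[of U Y] by simp
qed

end
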